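(* Let $S$ be a nonempty commutative semigroup and let $G$ be a nilpotent group of class $n$. The set $G_p^S$ of all polynomial maps $f:S\to G$ forms a nilpotent group of class $n$, with group law given by elementwise multiplication. In particular, $G$ can be viewed as a subgroup of $G_p^S$ (by identifying an element of $G$ with the constant map taking that value).
   Context: Let $S$ be a nonempty commutative semigroup (written additively) and $G$ a group with identity $1_G$. A map $f:S\to G$ is a polynomial map of degree $-\infty$ if $f(s)=1_G$ for all $s$, and of degree $0$ if it is constant with value different from $1_G$. Thus degree $\le 0$ means constant. Inductively, for $d\in\{0,1,2,\dots\}$, $f$ is a polynomial map of degree $\le d+1$ if for every $s\in S$ both maps $L_s(f):t\mapsto f(s+t)f(t)^{-1}$ and $R_s(f):t\mapsto f(t)^{-1}f(s+t)$ from $S$ to $G$ are polynomial maps of degree $\le d$. The degree of a polynomial map is the least such $d\in\{-\infty,0,1,2,\dots\}$. A map is a polynomial map if it is a polynomial map of degree $\le d$ for some $d$. *)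

theory Defs
  imports "HOL-Algebra.Algebra"
begin

locale commutative_semigroup =
  fixes S :: "'s set" and sadd :: "'s \<Rightarrow> 's \<Rightarrow> 's"
  assumes sadd_closed: "\<lbrakk>s \<in> S; t \<in> S\<rbrakk> \<Longrightarrow> sadd s t \<in> S"
    and sadd_assoc: "\<lbrakk>s \<in> S; t \<in> S; u \<in> S\<rbrakk> \<Longrightarrow> sadd (sadd s t) u = sadd s (sadd t u)"
    and sadd_commute: "\<lbrakk>s \<in> S; t \<in> S\<rbrakk> \<Longrightarrow> sadd s t = sadd t s"

(* The commutator [x, y] is x y x^-1 y^-1, as in the library's derived_set. *)

definition commutator_subgroup :: "('a, 'b) monoid_scheme \<Rightarrow> 'a set \<Rightarrow> 'a set \<Rightarrow> 'a set"
  where "commutator_subgroup G H K =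
    generate G {x \<otimes>\<^bsub>G\<^esub> y \<otimes>\<^bsub>G\<^esub> inv\<^bsub>G\<^esub> x \<otimes>\<^bsub>G\<^esub> inv\<^bsub>G\<^esub> y | x y. x \<in> H \<and> y \<in> K}"

(* Indexing starts at 0: lower_central_series G k is the subgroup usually called gamma_(k+1),
   so that class n means that the n-th term is the first trivial one. *)

primrec lower_central_series :: "('a, 'b) monoid_scheme \<Rightarrow> nat \<Rightarrow> 'a set"
  where
    "lower_central_series G 0 = carrier G"
  | "lower_central_series G (Suc k) =
       commutator_subgroup G (lower_central_series G k) (carrier G)"

locale nilpotent_group = group +
  assumes nilpotent: "\<exists>k. lower_central_series G k = {\<one>}"

definition nilpotency_class :: "('a, 'b) monoid_scheme \<Rightarrow> nat"
  where "nilpotency_class G = (LEAST k. lower_central_series G k = {\<one>\<^bsub>G\<^esub>})"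

(* Maps from S to G are represented by the elements of the extensional function space
   S \<rightarrow>\<^sub>E carrier G, as in product_group. *)

definition left_difference ::
    "('s \<Rightarrow> 's \<Rightarrow> 's) \<Rightarrow> 's set \<Rightarrow> ('g, 'b) monoid_scheme \<Rightarrow> 's \<Rightarrow> ('s \<Rightarrow> 'g) \<Rightarrow> 's \<Rightarrow> 'g"
  where "left_difference sadd S G s f = (\<lambda>t\<in>S. f (sadd s t) \<otimes>\<^bsub>G\<^esub> inv\<^bsub>G\<^esub> (f t))"

definition right_difference ::
    "('s \<Rightarrow> 's \<Rightarrow> 's) \<Rightarrow> 's set \<Rightarrow> ('g, 'b) monoid_scheme \<Rightarrow> 's \<Rightarrow> ('s \<Rightarrow> 'g) \<Rightarrow> 's \<Rightarrow> 'g"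
  where "right_difference sadd S G s f = (\<lambda>t\<in>S. inv\<^bsub>G\<^esub> (f t) \<otimes>\<^bsub>G\<^esub> f (sadd s t))"

(* The zero case covers both degree minus infinity (constant with value 1) and degree 0
   (constant with another value). *)

primrec poly_degree_le ::
    "('s \<Rightarrow> 's \<Rightarrow> 's) \<Rightarrow> 's set \<Rightarrow> ('g, 'b) monoid_scheme \<Rightarrow> nat \<Rightarrow> ('s \<Rightarrow> 'g) \<Rightarrow> bool"
  where
    "poly_degree_le sadd S G 0 f \<longleftrightarrow> (\<exists>c\<in>carrier G. \<forall>s\<in>S. f s = c)"
  | "poly_degree_le sadd S G (Suc d) f \<longleftrightarrow>
       (\<forall>s\<in>S. poly_degree_le sadd S G d (left_difference sadd S G s f) \<and>
              poly_degree_le sadd S G d (right_difference sadd S G s f))"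

definition polynomial_maps ::
    "('s \<Rightarrow> 's \<Rightarrow> 's) \<Rightarrow> 's set \<Rightarrow> ('g, 'b) monoid_scheme \<Rightarrow> ('s \<Rightarrow> 'g) set"
  where "polynomial_maps sadd S G = {f \<in> S \<rightarrow>\<^sub>E carrier G. \<exists>d. poly_degree_le sadd S G d f}"

definition polynomial_map_group ::
    "('s \<Rightarrow> 's \<Rightarrow> 's) \<Rightarrow> 's set \<Rightarrow> ('g, 'b) monoid_scheme \<Rightarrow> ('s \<Rightarrow> 'g) monoid"
  where "polynomial_map_group sadd S G =
    (product_group S (\<lambda>_. G))\<lparr>carrier := polynomial_maps sadd S G\<rparr>"

definition constant_map :: "'s set \<Rightarrow> 'g \<Rightarrow> 's \<Rightarrow> 'g"
  where "constant_map S c = (\<lambda>s\<in>S. c)"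

end

theory Submission
  imports Defs
begin

text \<open>
  The difficulty is that the degree of a product can exceed the degrees of both factors: already
  \<open>L\<^sub>s(f g)\<close> contains the commutator of \<open>f\<close> with \<open>L\<^sub>s(g)\<close>, in which \<open>f\<close> has not been differenced.
  The remedy, due to Lazard and Leibman, is to replace the degree by a filtration
  \<open>F\<^sub>0 \<supseteq> F\<^sub>1 \<supseteq> \<dots>\<close> of \<open>G\<close> with \<open>[F\<^sub>i, F\<^sub>j] \<subseteq> F\<^bsub>i+j\<^esub>\<close>, and to ask of a map that all its
  \<open>k\<close>-fold differences take values in \<open>F\<^sub>k\<close>.

  The maps with this property form a group for a reason that has little to do with maps. Let a
  group carry commuting endomorphisms \<open>T\<^sub>s\<close> and a filtration stable under them. Then the elements
  \<open>x\<close> of \<open>F\<^sub>k\<close> with \<open>T\<^sub>s(x) x\<inverse> \<in> F\<^bsub>k+1\<^esub>\<close> for all \<open>s\<close> form, as \<open>k\<close> varies, again a stable filtration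
  (lemma \<open>filtration_refine\<close>), because the differences of products, inverses and commutators are
  products of differences and commutators of sufficiently large weight. Here the group is the group
  of all maps from \<open>S\<close> to \<open>G\<close>, the endomorphisms are the translations, and refining \<open>m\<close> times
  controls the first \<open>m\<close> differences.

  Having degree at most \<open>d\<close> does not restrict the values of the first \<open>d\<close> differences, so one needs
  \<open>F\<^sub>0 = \<dots> = F\<^sub>d = G\<close>; the lower central series slowed down by the factor \<open>d\<close> does this. It still
  reaches the trivial group, so that conversely every map adapted to it is a polynomial map.
  As \<open>d\<close> can be chosen for two maps at once, the polynomial maps form a group. Finally,
  homomorphisms respect lower central series. The constant maps embed \<open>G\<close> into this group and the
  evaluations at the points of \<open>S\<close> jointly embed the group into a power of \<open>G\<close>, so the two lower
  central series become trivial at the same step.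
\<close>

section \<open>Commutator identities\<close>

definition (in group) commutator :: "'a \<Rightarrow> 'a \<Rightarrow> 'a"
  where "commutator x y = x \<otimes> y \<otimes> inv x \<otimes> inv y"

context group
begin

lemma inv_mult_cancel_left:
  assumes "x \<in> carrier G" "y \<in> carrier G"
  shows "x \<otimes> (inv x \<otimes> y) = y" "inv x \<otimes> (x \<otimes> y) = y"
  using assms by (simp_all add: m_assoc[symmetric])

text \<open>
  Rewriting with these equations brings a word into freely reduced form, and so decides identities
  that hold in all groups.
\<close>

lemmas free_reduction = commutator_def m_assoc inv_mult_group inv_inv inv_one
  l_one r_one l_inv r_inv inv_mult_cancel_left m_closed inv_closed one_closed

lemma commutator_closed [simp]:
  "\<lbrakk>x \<in> carrier G; y \<in> carrier G\<rbrakk> \<Longrightarrow> commutator x y \<in> carrier G"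
  by (simp add: commutator_def)

lemma inv_commutator:
  "\<lbrakk>x \<in> carrier G; y \<in> carrier G\<rbrakk> \<Longrightarrow> inv (commutator x y) = commutator y x"
  by (simp only: free_reduction)

lemma conjugate_eq_commutator_mult:
  "\<lbrakk>x \<in> carrier G; y \<in> carrier G\<rbrakk> \<Longrightarrow> x \<otimes> y \<otimes> inv x = commutator x y \<otimes> y"
  by (simp only: free_reduction)

lemma commutator_mult_left:
  "\<lbrakk>x \<in> carrier G; y \<in> carrier G; z \<in> carrier G\<rbrakk>
    \<Longrightarrow> commutator (x \<otimes> y) z = commutator x (commutator y z) \<otimes> commutator y z \<otimes> commutator x z"
  by (simp only: free_reduction)

lemma commutator_mult_right:
  "\<lbrakk>x \<in> carrier G; y \<in> carrier G; z \<in> carrier G\<rbrakk>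
    \<Longrightarrow> commutator x (y \<otimes> z) = commutator x y \<otimes> (y \<otimes> commutator x z \<otimes> inv y)"
  by (simp only: free_reduction)

lemma commutator_inv_right:
  "\<lbrakk>x \<in> carrier G; y \<in> carrier G\<rbrakk>
    \<Longrightarrow> commutator x (inv y) = inv y \<otimes> inv (commutator x y) \<otimes> inv (inv y)"
  by (simp only: free_reduction)

lemma Hall_Witt:
  assumes "x \<in> carrier G" "y \<in> carrier G" "z \<in> carrier G"
  shows "(y \<otimes> commutator x (commutator (inv y) z) \<otimes> inv y)
    \<otimes> (z \<otimes> commutator y (commutator (inv z) x) \<otimes> inv z)
    \<otimes> (x \<otimes> commutator z (commutator (inv x) y) \<otimes> inv x) = \<one>"
  using assms by (simp only: free_reduction)

text \<open>
  By the Hall-Witt identity a conjugate of the third triple commutator is the inverse of a product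
  of conjugates of the other two.
\<close>

lemma three_subgroups:
  assumes "N \<lhd> G" and xyz: "x \<in> carrier G" "y \<in> carrier G" "z \<in> carrier G"
    and "commutator y (commutator (inv z) x) \<in> N"
    and "commutator z (commutator (inv x) y) \<in> N"
  shows "commutator x (commutator (inv y) z) \<in> N"
proof -
  interpret N: normal N G by fact
  define a where "a = commutator x (commutator (inv y) z)"
  define b where "b = z \<otimes> commutator y (commutator (inv z) x) \<otimes> inv z"
  define c where "c = x \<otimes> commutator z (commutator (inv x) y) \<otimes> inv x"
  have b: "b \<in> N" and c: "c \<in> N"
    using assms by (simp_all add: b_def c_def N.inv_op_closed2)
  have carr: "a \<in> carrier G" "b \<in> carrier G" "c \<in> carrier G"
    using xyz b c by (auto simp: a_def)
  have "(y \<otimes> a \<otimes> inv y) \<otimes> b \<otimes> c = \<one>"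
    using Hall_Witt[OF xyz] by (simp only: a_def b_def c_def)
  then have "(y \<otimes> a \<otimes> inv y) \<otimes> (b \<otimes> c) = \<one>"
    using carr xyz by (metis m_assoc m_closed inv_closed)
  then have "y \<otimes> a \<otimes> inv y = inv (b \<otimes> c)"
    using carr xyz by (metis inv_equality inv_closed inv_inv m_closed)
  then have "a = inv y \<otimes> inv (b \<otimes> c) \<otimes> y"
    using carr xyz by (metis inv_solve_left inv_solve_right inv_closed m_assoc m_closed)
  then show ?thesis
    using b c xyz N.inv_op_closed1[of y "inv (b \<otimes> c)"] by (simp add: a_def)
qed

end

section \<open>The lower central series\<close>

context group
begin

lemma lower_central_series_Suc:
  "lower_central_series G (Suc k) =
    generate G {commutator x y | x y. x \<in> lower_central_series G k \<and> y \<in> carrier G}"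
  by (simp add: commutator_subgroup_def commutator_def)

lemma normal_lower_central_series: "lower_central_series G k \<lhd> G"
proof (induction k)
  case 0
  show ?case by (simp add: normal_inv_iff subgroup_self)
next
  case (Suc k)
  then interpret N: normal "lower_central_series G k" G .
  show ?case
    unfolding lower_central_series_Suc
  proof (rule normal_generateI)
    show "{commutator x y |x y. x \<in> lower_central_series G k \<and> y \<in> carrier G} \<subseteq> carrier G"
      by auto
    fix h g
    assume "h \<in> {commutator x y |x y. x \<in> lower_central_series G k \<and> y \<in> carrier G}"
      and g: "g \<in> carrier G"
    then obtain x y where h: "h = commutator x y"
      and x: "x \<in> lower_central_series G k" and y: "y \<in> carrier G"
      by auto
    have "g \<otimes> h \<otimes> inv g = commutator (g \<otimes> x \<otimes> inv g) (g \<otimes> y \<otimes> inv g)"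
      using N.mem_carrier[OF x] y g by (simp only: h free_reduction)
    then show "g \<otimes> h \<otimes> inv g
        \<in> {commutator x y |x y. x \<in> lower_central_series G k \<and> y \<in> carrier G}"
      using x y g N.inv_op_closed2[OF g x] by blast
  qed
qed

lemma subgroup_lower_central_series: "subgroup (lower_central_series G k) G"
  using normal_lower_central_series by (simp add: normal_inv_iff)

lemma commutator_in_lower_central_series_Suc:
  "\<lbrakk>x \<in> lower_central_series G k; y \<in> carrier G\<rbrakk>
    \<Longrightarrow> commutator x y \<in> lower_central_series G (Suc k)"
  unfolding lower_central_series_Suc by (blast intro: generate.incl)

lemma lower_central_series_Suc_subset:
  "lower_central_series G (Suc k) \<subseteq> lower_central_series G k"
proof -
  interpret N: normal "lower_central_series G k" G
    by (rule normal_lower_central_series)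
  have "commutator x y \<in> lower_central_series G k"
    if "x \<in> lower_central_series G k" and y: "y \<in> carrier G" for x y
  proof -
    have "commutator x y = x \<otimes> (y \<otimes> inv x \<otimes> inv y)"
      using that N.mem_carrier by (simp only: free_reduction)
    then show ?thesis
      using that N.inv_op_closed2[OF y, of "inv x"] by simp
  qed
  then show ?thesis
    unfolding lower_central_series_Suc
    by (intro generate_subgroup_incl subgroup_lower_central_series) auto
qed

lemma lower_central_series_antimono:
  "i \<le> j \<Longrightarrow> lower_central_series G j \<subseteq> lower_central_series G i"
  by (rule lift_Suc_antimono_le[of "lower_central_series G"]) (rule lower_central_series_Suc_subset)

text \<open>
  For fixed \<open>i\<close>, the elements whose commutators with the \<open>i\<close>-th term fall into a given normal
  subgroup form a subgroup. This reduces the claim to generators of the \<open>j\<close>-th term, which are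
  themselves commutators, and for those the three subgroups lemma lowers \<open>j\<close>.
  In the usual numbering this is the inclusion of \<open>[\<gamma>\<^sub>a, \<gamma>\<^sub>b]\<close> in \<open>\<gamma>\<^bsub>a+b\<^esub>\<close>; the successor accounts
  for the numbering starting at zero.
\<close>

lemma commutator_in_lower_central_series:
  "\<lbrakk>x \<in> lower_central_series G i; y \<in> lower_central_series G j\<rbrakk>
    \<Longrightarrow> commutator x y \<in> lower_central_series G (Suc (i + j))"
proof (induction j arbitrary: i x y)
  case 0
  then show ?case using commutator_in_lower_central_series_Suc[of x i y] by simp
next
  case (Suc j)
  let ?N = "lower_central_series G (Suc (i + Suc j))"
  let ?C = "{y \<in> carrier G. \<forall>x \<in> lower_central_series G i. commutator x y \<in> ?N}"
  interpret N: normal ?N G by (rule normal_lower_central_series)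
  interpret I: subgroup "lower_central_series G i" G by (rule subgroup_lower_central_series)
  interpret J: subgroup "lower_central_series G j" G by (rule subgroup_lower_central_series)
  have "subgroup ?C G"
  proof (rule subgroupI)
    have "commutator x \<one> = \<one>" if "x \<in> lower_central_series G i" for x
      using I.mem_carrier[OF that] by (simp add: commutator_def)
    then have "\<one> \<in> ?C" using N.one_closed by (simp del: lower_central_series.simps)
    then show "?C \<noteq> {}" by blast
  next
    fix a assume a: "a \<in> ?C"
    have "commutator x (inv a) \<in> ?N" if x: "x \<in> lower_central_series G i" for x
      using a x I.mem_carrier[OF x] N.inv_op_closed2[of "inv a" "inv (commutator x a)"]
      by (simp only: commutator_inv_right mem_Collect_eq inv_closed N.m_inv_closed)
    then show "inv a \<in> ?C" using a by simp
  next
    fix a b assume a: "a \<in> ?C" and b: "b \<in> ?C"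
    have "commutator x (a \<otimes> b) \<in> ?N" if x: "x \<in> lower_central_series G i" for x
      using a b x I.mem_carrier[OF x] N.inv_op_closed2[of a "commutator x b"]
      by (simp only: commutator_mult_right mem_Collect_eq N.m_closed)
    then show "a \<otimes> b \<in> ?C" using a b by simp
  qed auto
  moreover have "commutator u v \<in> ?C"
    if u: "u \<in> lower_central_series G j" and v: "v \<in> carrier G" for u v
  proof -
    have "commutator x (commutator u v) \<in> ?N" if x: "x \<in> lower_central_series G i" for x
    proof -
      have carr: "x \<in> carrier G" "u \<in> carrier G"
        using x u by (auto intro: I.mem_carrier J.mem_carrier)
      have "commutator x (inv v) \<in> lower_central_series G (Suc i)"
        using x v by (intro commutator_in_lower_central_series_Suc) auto
      then have "inv (commutator x (inv v)) \<in> lower_central_series G (Suc i)"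
        by (rule subgroup.m_inv_closed[OF subgroup_lower_central_series])
      then have "commutator (commutator (inv v) x) (inv u) \<in> ?N"
        using Suc.IH[of "commutator (inv v) x" "Suc i" "inv u"] u v carr
        by (simp only: inv_commutator inv_closed J.m_inv_closed add_Suc add_Suc_right)
      then have "inv (commutator (commutator (inv v) x) (inv u)) \<in> ?N"
        by (rule N.m_inv_closed)
      then have 1: "commutator (inv u) (commutator (inv v) x) \<in> ?N"
        using carr v by (simp only: inv_commutator inv_closed commutator_closed)
      have "commutator (inv x) (inv u) \<in> lower_central_series G (Suc (i + j))"
        using x u by (intro Suc.IH) auto
      then have "commutator (commutator (inv x) (inv u)) v \<in> ?N"
        using commutator_in_lower_central_series_Suc v
        by (simp only: add_Suc_right)
      then have "inv (commutator (commutator (inv x) (inv u)) v) \<in> ?N"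
        by (rule N.m_inv_closed)
      then have 2: "commutator v (commutator (inv x) (inv u)) \<in> ?N"
        using carr v by (simp only: inv_commutator inv_closed commutator_closed)
      have "commutator x (commutator (inv (inv u)) v) \<in> ?N"
        by (rule three_subgroups[OF normal_lower_central_series carr(1) inv_closed[OF carr(2)] v 1 2])
      then show ?thesis using carr by simp
    qed
    then show ?thesis using J.mem_carrier[OF u] v by simp
  qed
  ultimately have "lower_central_series G (Suc j) \<subseteq> ?C"
    unfolding lower_central_series_Suc by (intro generate_subgroup_incl) auto
  then show ?case using Suc.prems by blast
qed

end

lemma (in group_hom) image_lower_central_series:
  "h ` lower_central_series G k \<subseteq> lower_central_series H k"
proof (induction k)
  case 0
  show ?case by auto
next
  case (Suc k)
  let ?K = "{G.commutator x y |x y. x \<in> lower_central_series G k \<and> y \<in> carrier G}"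
  have sub: "lower_central_series G k \<subseteq> carrier G"
    using G.subgroup_lower_central_series by (rule subgroup.subset)
  have "h (G.commutator x y) = H.commutator (h x) (h y)"
    if "x \<in> carrier G" "y \<in> carrier G" for x y
    using that by (simp add: G.commutator_def H.commutator_def)
  then have "h ` ?K \<subseteq> lower_central_series H (Suc k)"
    using Suc.IH sub
    by (fastforce simp del: lower_central_series.simps
        intro: H.commutator_in_lower_central_series_Suc)
  moreover have "h ` generate G ?K = generate H (h ` ?K)"
    using sub by (intro generate_img[symmetric]) auto
  ultimately show ?case
    unfolding G.lower_central_series_Suc
    using H.generate_subgroup_incl[OF _ H.subgroup_lower_central_series] by blast
qed

section \<open>Filtrations and their refinement\<close>

context group
begin

definition filtration :: "(nat \<Rightarrow> 'a set) \<Rightarrow> bool"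
  where "filtration F \<longleftrightarrow> (\<forall>k. subgroup (F k) G) \<and> (\<forall>k. F (Suc k) \<subseteq> F k)
    \<and> (\<forall>i j. \<forall>x \<in> F i. \<forall>y \<in> F j. commutator x y \<in> F (i + j))"

lemma filtration_antimono: "filtration F \<Longrightarrow> i \<le> j \<Longrightarrow> F j \<subseteq> F i"
  using lift_Suc_antimono_le[of F] by (simp add: filtration_def)

text \<open>
  The lower central series slowed down by the factor \<open>d\<close>. With truncated subtraction its terms
  \<open>0, \<dots>, d\<close> are the whole group, so the terms with positive index follow the series
  \<open>\<gamma>\<^sub>1, \<gamma>\<^sub>2, \<dots>\<close> in such a way that the \<open>k\<close>-th one is \<open>\<gamma>\<^sub>m\<close> for \<open>m = \<lceil>k / d\<rceil>\<close>. Superadditivity is then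
  the inequality \<open>\<lceil>(i + j) / d\<rceil> \<le> \<lceil>i / d\<rceil> + \<lceil>j / d\<rceil>\<close>.
\<close>

lemma filtration_slow_lower_central_series:
  assumes "d > 0"
  shows "filtration (\<lambda>k. lower_central_series G ((k - 1) div d))"
  unfolding filtration_def
proof (intro conjI allI ballI)
  show "subgroup (lower_central_series G ((k - 1) div d)) G" for k
    by (rule subgroup_lower_central_series)
  show "lower_central_series G ((Suc k - 1) div d) \<subseteq> lower_central_series G ((k - 1) div d)" for k
    by (intro lower_central_series_antimono div_le_mono) simp
  fix i j x y
  assume "x \<in> lower_central_series G ((i - 1) div d)" "y \<in> lower_central_series G ((j - 1) div d)"
  then have "commutator x y \<in> lower_central_series G (Suc ((i - 1) div d + (j - 1) div d))"
    by (rule commutator_in_lower_central_series)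
  moreover have "(i + j - 1) div d \<le> Suc ((i - 1) div d + (j - 1) div d)"
  proof -
    have i: "i \<le> d * ((i - 1) div d) + d" and j: "j \<le> d * ((j - 1) div d) + d"
      using assms mod_less_divisor[OF assms, of "i - 1"] mod_less_divisor[OF assms, of "j - 1"]
        mult_div_mod_eq[of d "i - 1"] mult_div_mod_eq[of d "j - 1"] by linarith+
    have "i + j - 1 < d * (Suc (Suc ((i - 1) div d + (j - 1) div d)))"
      using i j assms by (simp add: algebra_simps)
    then have "(i + j - 1) div d < Suc (Suc ((i - 1) div d + (j - 1) div d))"
      using assms by (simp add: less_mult_imp_div_less mult.commute)
    then show ?thesis by simp
  qed
  ultimately show "commutator x y \<in> lower_central_series G ((i + j - 1) div d)"
    using lower_central_series_antimono by blast
qed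

end

locale commuting_endomorphisms = group +
  fixes I :: "'s set" and T :: "'s \<Rightarrow> 'a \<Rightarrow> 'a"
  assumes T_hom: "s \<in> I \<Longrightarrow> T s \<in> hom G G"
    and T_commute: "\<lbrakk>s \<in> I; u \<in> I; x \<in> carrier G\<rbrakk> \<Longrightarrow> T s (T u x) = T u (T s x)"
begin

definition difference :: "'s \<Rightarrow> 'a \<Rightarrow> 'a"
  where "difference s x = T s x \<otimes> inv x"

definition stable :: "(nat \<Rightarrow> 'a set) \<Rightarrow> bool"
  where "stable F \<longleftrightarrow> (\<forall>k. \<forall>s \<in> I. T s ` F k \<subseteq> F k)"

definition refine :: "(nat \<Rightarrow> 'a set) \<Rightarrow> nat \<Rightarrow> 'a set"
  where "refine F k = {x \<in> F k. \<forall>s \<in> I. difference s x \<in> F (Suc k)}"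

lemma T_closed [simp]: "\<lbrakk>s \<in> I; x \<in> carrier G\<rbrakk> \<Longrightarrow> T s x \<in> carrier G"
  using hom_in_carrier[OF T_hom] .

lemma T_mult [simp]:
  "\<lbrakk>s \<in> I; x \<in> carrier G; y \<in> carrier G\<rbrakk> \<Longrightarrow> T s (x \<otimes> y) = T s x \<otimes> T s y"
  using T_hom by (rule hom_mult)

lemma T_inv [simp]: "\<lbrakk>s \<in> I; x \<in> carrier G\<rbrakk> \<Longrightarrow> T s (inv x) = inv (T s x)"
  using group_hom.hom_inv[of G G "T s" x] T_hom by (simp add: group_hom_def group_hom_axioms_def)

lemma difference_closed [simp]: "\<lbrakk>s \<in> I; x \<in> carrier G\<rbrakk> \<Longrightarrow> difference s x \<in> carrier G"
  by (simp add: difference_def)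

lemma T_eq_difference_mult:
  "\<lbrakk>s \<in> I; x \<in> carrier G\<rbrakk> \<Longrightarrow> T s x = difference s x \<otimes> x"
  by (simp add: difference_def m_assoc)

lemma difference_mult:
  assumes "s \<in> I" "x \<in> carrier G" "y \<in> carrier G"
  shows "difference s (x \<otimes> y)
    = difference s x \<otimes> commutator x (difference s y) \<otimes> difference s y"
  using assms by (simp only: difference_def T_mult T_inv T_closed free_reduction)

lemma difference_inv:
  assumes "s \<in> I" "x \<in> carrier G"
  shows "difference s (inv x) = commutator (inv x) (inv (difference s x)) \<otimes> inv (difference s x)"
  using assms by (simp only: difference_def T_mult T_inv T_closed free_reduction)

text \<open>
  Every factor on the right has weight larger than the weight of the commutator of \<open>x\<close> and \<open>y\<close> as
  soon as each difference counts one more than its argument and \<open>T\<close> preserves weights.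
\<close>

lemma difference_commutator:
  assumes "s \<in> I" "x \<in> carrier G" "y \<in> carrier G"
  shows "difference s (commutator x y)
    = commutator (difference s x) (commutator x (T s y))
      \<otimes> commutator x (difference s y)
      \<otimes> commutator (difference s y) (commutator x y)
      \<otimes> commutator (commutator x y) (commutator (difference s x) (T s y))
      \<otimes> commutator (difference s x) (T s y)"
proof -
  define a b c where "a = difference s x" and "b = difference s y" and "c = T s y"
  have carr: "a \<in> carrier G" "b \<in> carrier G" "c \<in> carrier G"
    using assms by (simp_all add: a_def b_def c_def)
  have "T s (commutator x y) = commutator (T s x) c"
    using assms by (simp add: commutator_def c_def)
  also have "T s x = a \<otimes> x"
    using assms by (simp add: a_def T_eq_difference_mult)
  also have "commutator (a \<otimes> x) c = commutator a (commutator x c) \<otimes> commutator x c \<otimes> commutator a c"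
    using carr assms by (intro commutator_mult_left)
  finally have T: "T s (commutator x y)
    = commutator a (commutator x c) \<otimes> commutator x c \<otimes> commutator a c" .
  have "commutator x c = commutator x (b \<otimes> y)"
    using assms by (simp add: b_def c_def T_eq_difference_mult)
  also have "\<dots> = commutator x b \<otimes> (commutator b (commutator x y) \<otimes> commutator x y)"
    using carr assms by (simp only: commutator_mult_right conjugate_eq_commutator_mult
        commutator_closed)
  finally have "difference s (commutator x y)
    = commutator a (commutator x c)
      \<otimes> (commutator x b \<otimes> (commutator b (commutator x y) \<otimes> commutator x y))
      \<otimes> commutator a c \<otimes> inv (commutator x y)"
    using T by (simp only: difference_def)
  also have "\<dots> = commutator a (commutator x c) \<otimes> commutator x b \<otimes> commutator b (commutator x y)
      \<otimes> (commutator x y \<otimes> commutator a c \<otimes> inv (commutator x y))"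
    using carr assms by (simp only: m_assoc m_closed inv_closed commutator_closed)
  also have "\<dots> = commutator a (commutator x c) \<otimes> commutator x b \<otimes> commutator b (commutator x y)
      \<otimes> (commutator (commutator x y) (commutator a c) \<otimes> commutator a c)"
    using carr assms by (simp only: conjugate_eq_commutator_mult commutator_closed)
  finally show ?thesis
    using carr assms by (simp only: m_assoc m_closed commutator_closed a_def b_def c_def)
qed

lemma stable_refine:
  assumes "filtration F" "stable F"
  shows "stable (refine F)"
  unfolding stable_def
proof (intro allI ballI image_subsetI)
  fix k s x assume s: "s \<in> I" and x: "x \<in> refine F k"
  have xc: "x \<in> carrier G"
    using x assms(1) subgroup.mem_carrier[of "F k" G x] by (simp add: refine_def filtration_def)
  have "difference u (T s x) = T s (difference u x)" if "u \<in> I" for u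
    using that s xc by (simp add: difference_def T_commute[of u s])
  then show "T s x \<in> refine F k"
    using x s assms(2) by (auto simp: refine_def stable_def image_subset_iff)
qed

text \<open>
  The refined terms are again subgroups because commutators with a difference have at least the
  weight of that difference. The refined estimate asks for the difference of a commutator to have
  weight one more than the commutator, which can be read off from its factorization.
\<close>

lemma filtration_refine:
  assumes F: "filtration F" and st: "stable F"
  shows "filtration (refine F)"
  unfolding filtration_def
proof (intro conjI allI ballI)
  have sg: "subgroup (F k) G" for k using F by (simp add: filtration_def)
  have carr: "x \<in> carrier G" if "x \<in> F k" for x k
    using subgroup.mem_carrier[OF sg that] .
  have mult: "x \<otimes> y \<in> F k" if "x \<in> F k" "y \<in> F k" for x y k
    using subgroup.m_closed[OF sg that] .
  have comm: "commutator x y \<in> F k" if "x \<in> F i" "y \<in> F j" "k \<le> i + j" for x y i j k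
    using F that filtration_antimono[OF F \<open>k \<le> i + j\<close>] by (auto simp: filtration_def)
  have T: "T s x \<in> F k" if "s \<in> I" "x \<in> F k" for s x k
    using st that by (auto simp: stable_def)
  show "subgroup (refine F k) G" for k
  proof (rule subgroupI)
    show "refine F k \<subseteq> carrier G" by (auto simp: refine_def carr)
    have "difference s \<one> = \<one>" if "s \<in> I" for s
      using that T_hom by (simp add: difference_def hom_one)
    then have "\<one> \<in> refine F k"
      by (simp add: refine_def subgroup.one_closed[OF sg])
    then show "refine F k \<noteq> {}" by blast
  next
    fix x assume x: "x \<in> refine F k"
    have "difference s (inv x) \<in> F (Suc k)" if s: "s \<in> I" for s
    proof -
      have ix: "inv x \<in> F k" and id: "inv (difference s x) \<in> F (Suc k)"
        using x s by (auto simp: refine_def subgroup.m_inv_closed[OF sg])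
      have "commutator (inv x) (inv (difference s x)) \<in> F (Suc k)"
        by (rule comm[OF ix id]) simp
      then show ?thesis
        using s id x by (auto simp: refine_def difference_inv carr intro: mult)
    qed
    then show "inv x \<in> refine F k"
      using x by (auto simp: refine_def subgroup.m_inv_closed[OF sg])
  next
    fix x y assume x: "x \<in> refine F k" and y: "y \<in> refine F k"
    have "difference s (x \<otimes> y) \<in> F (Suc k)" if s: "s \<in> I" for s
    proof -
      have "x \<in> F k" "y \<in> F k" "difference s x \<in> F (Suc k)" and dy: "difference s y \<in> F (Suc k)"
        using x y s by (auto simp: refine_def)
      moreover have "commutator x (difference s y) \<in> F (Suc k)"
        by (rule comm[OF \<open>x \<in> F k\<close> dy]) simp
      ultimately show ?thesis
        using s by (simp add: difference_mult carr mult)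
    qed
    then show "x \<otimes> y \<in> refine F k"
      using x y by (auto simp: refine_def intro: mult)
  qed
  show "refine F (Suc k) \<subseteq> refine F k" for k
    using F by (auto simp: refine_def filtration_def)
  fix i j x y assume x: "x \<in> refine F i" and y: "y \<in> refine F j"
  then have xF: "x \<in> F i" and yF: "y \<in> F j" by (auto simp: refine_def)
  have "difference s (commutator x y) \<in> F (Suc (i + j))" if s: "s \<in> I" for s
  proof -
    have dx: "difference s x \<in> F (Suc i)" and dy: "difference s y \<in> F (Suc j)"
      using x y s by (auto simp: refine_def)
    note Ty = T[OF s yF]
    have xTy: "commutator x (T s y) \<in> F (i + j)" and xy: "commutator x y \<in> F (i + j)"
      and dxTy: "commutator (difference s x) (T s y) \<in> F (Suc (i + j))"
      and xdy: "commutator x (difference s y) \<in> F (Suc (i + j))"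
      by (auto intro: comm[OF xF Ty] comm[OF xF yF] comm[OF dx Ty] comm[OF xF dy])
    moreover have "commutator (difference s x) (commutator x (T s y)) \<in> F (Suc (i + j))"
      by (rule comm[OF dx xTy]) simp
    moreover have "commutator (difference s y) (commutator x y) \<in> F (Suc (i + j))"
      by (rule comm[OF dy xy]) simp
    moreover have "commutator (commutator x y) (commutator (difference s x) (T s y))
        \<in> F (Suc (i + j))"
      by (rule comm[OF xy dxTy]) simp
    ultimately show ?thesis
      unfolding difference_commutator[OF s carr[OF xF] carr[OF yF]] by (intro mult)
  qed
  then show "commutator x y \<in> refine F (i + j)"
    using comm[OF xF yF] by (simp add: refine_def)
qed

lemma refine_funpow:
  assumes "filtration F" "stable F"
  shows "filtration ((refine ^^ m) F)" "stable ((refine ^^ m) F)"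
  using assms by (induction m) (simp_all add: filtration_refine stable_refine)

lemma mem_refine_iff:
  "x \<in> refine F k \<longleftrightarrow> x \<in> F k \<and> (\<forall>s \<in> I. difference s x \<in> F (Suc k))"
  by (simp add: refine_def)

text \<open>
  The right difference of \<open>x\<close> is the left one times its commutator with the inverse of \<open>x\<close>, and
  this commutator has at least the weight of the left difference.
\<close>

lemma right_difference_in_filtration:
  assumes "filtration F" "x \<in> F k" "s \<in> I" "difference s x \<in> F (Suc k)"
  shows "inv x \<otimes> T s x \<in> F (Suc k)"
proof -
  have sg: "subgroup (F i) G" for i using assms(1) by (simp add: filtration_def)
  have x: "x \<in> carrier G" using subgroup.mem_carrier[OF sg assms(2)] .
  have "inv x \<in> F k" using subgroup.m_inv_closed[OF sg assms(2)] .
  then have "commutator (inv x) (difference s x) \<in> F (k + Suc k)"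
    using assms(1,4) unfolding filtration_def by blast
  then have "commutator (inv x) (difference s x) \<in> F (Suc k)"
    using filtration_antimono[OF assms(1), of "Suc k" "k + Suc k"] by auto
  then have "commutator (inv x) (difference s x) \<otimes> difference s x \<in> F (Suc k)"
    using assms(4) by (rule subgroup.m_closed[OF sg])
  moreover have "commutator (inv x) (difference s x) \<otimes> difference s x = inv x \<otimes> T s x"
    using x assms(3) by (simp only: difference_def T_closed free_reduction)
  ultimately show ?thesis by simp
qed

end

section \<open>Maps from a commutative semigroup to a group\<close>

locale semigroup_group_maps = commutative_semigroup S sadd + group G
  for S :: "'s set" and sadd :: "'s \<Rightarrow> 's \<Rightarrow> 's" and G :: "('g, 'b) monoid_scheme" (structure)
begin

abbreviation maps :: "('s \<Rightarrow> 'g) monoid"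
  where "maps \<equiv> product_group S (\<lambda>_. G)"

definition translate :: "'s \<Rightarrow> ('s \<Rightarrow> 'g) \<Rightarrow> 's \<Rightarrow> 'g"
  where "translate s f = (\<lambda>t\<in>S. f (sadd s t))"

sublocale maps: commuting_endomorphisms maps S translate
proof (intro commuting_endomorphisms.intro commuting_endomorphisms_axioms.intro)
  show "group maps" by (simp add: is_group)
  show "translate s \<in> hom maps maps" if "s \<in> S" for s
    using that by (auto simp: hom_def translate_def PiE_iff sadd_closed intro!: restrict_ext)
  show "translate s (translate u f) = translate u (translate s f)"
    if "s \<in> S" "u \<in> S" "f \<in> carrier maps" for s u f
    using that sadd_closed
    by (auto simp: translate_def intro!: restrict_ext)
       (metis sadd_assoc sadd_commute)
qed

lemma left_difference_eq:
  assumes "f \<in> carrier maps"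
  shows "left_difference sadd S G s f = maps.difference s f"
  using assms is_group
  by (auto simp: left_difference_def maps.difference_def translate_def PiE_iff intro!: restrict_ext)

lemma right_difference_eq:
  assumes "f \<in> carrier maps"
  shows "right_difference sadd S G s f = inv\<^bsub>maps\<^esub> f \<otimes>\<^bsub>maps\<^esub> translate s f"
  using assms is_group
  by (auto simp: right_difference_def translate_def PiE_iff intro!: restrict_ext)

definition pointwise :: "(nat \<Rightarrow> 'g set) \<Rightarrow> nat \<Rightarrow> ('s \<Rightarrow> 'g) set"
  where "pointwise F k = (S \<rightarrow>\<^sub>E F k)"

lemma commutator_maps:
  assumes "f \<in> carrier maps" "g \<in> carrier maps"
  shows "maps.commutator f g = (\<lambda>t\<in>S. commutator (f t) (g t))"
  using assms is_group by (auto simp: maps.commutator_def commutator_def intro!: restrict_ext)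

lemma filtration_pointwise:
  assumes "filtration F"
  shows "maps.filtration (pointwise F)"
  unfolding maps.filtration_def
proof (intro conjI allI ballI)
  have sg: "subgroup (F k) G" for k using assms by (simp add: filtration_def)
  show "subgroup (pointwise F k) maps" for k
    unfolding pointwise_def using sg by (simp add: PiE_subgroup_product_group is_group)
  then have carr: "f \<in> carrier maps" if "f \<in> pointwise F k" for f k
    using that by (rule subgroup.mem_carrier)
  show "pointwise F (Suc k) \<subseteq> pointwise F k" for k
    unfolding pointwise_def using assms by (intro PiE_mono) (simp add: filtration_def)
  fix i j f g assume f: "f \<in> pointwise F i" and g: "g \<in> pointwise F j"
  show "maps.commutator f g \<in> pointwise F (i + j)"
    unfolding commutator_maps[OF carr[OF f] carr[OF g]]
    using f g assms by (auto simp: pointwise_def PiE_iff filtration_def)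
qed

lemma stable_pointwise: "maps.stable (pointwise F)"
  by (auto simp: maps.stable_def pointwise_def translate_def PiE_iff sadd_closed)

text \<open>
  Each difference raises the weight by one, so the \<open>m\<close>-fold differences of \<open>f\<close> take values in the
  trivial group \<open>F N\<close>.
\<close>

lemma poly_degree_le_if_refined:
  assumes F: "filtration F" and triv: "F N = {\<one>}"
  shows "\<lbrakk>f \<in> (maps.refine ^^ m) (pointwise F) k; N \<le> k + m\<rbrakk> \<Longrightarrow> poly_degree_le sadd S G m f"
proof (induction m arbitrary: k f)
  case 0
  then have "f \<in> S \<rightarrow>\<^sub>E F N"
    using filtration_antimono[OF F, of N k] by (auto simp: pointwise_def)
  then show ?case by (auto simp: triv intro!: bexI[of _ \<one>])
next
  case (Suc m)
  let ?P = "(maps.refine ^^ m) (pointwise F)"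
  have P: "maps.filtration ?P"
    by (intro maps.refine_funpow filtration_pointwise stable_pointwise F)
  have f: "f \<in> ?P k" and d: "\<And>s. s \<in> S \<Longrightarrow> maps.difference s f \<in> ?P (Suc k)"
    using Suc.prems(1) by (auto simp: maps.mem_refine_iff)
  have fc: "f \<in> carrier maps"
    using f P subgroup.mem_carrier[of "?P k" maps f] unfolding maps.filtration_def by blast
  have "poly_degree_le sadd S G m (left_difference sadd S G s f)
      \<and> poly_degree_le sadd S G m (right_difference sadd S G s f)" if s: "s \<in> S" for s
    unfolding left_difference_eq[OF fc] right_difference_eq[OF fc]
  proof
    have "N \<le> Suc k + m" using Suc.prems(2) by simp
    then show "poly_degree_le sadd S G m (maps.difference s f)"
      "poly_degree_le sadd S G m (inv\<^bsub>maps\<^esub> f \<otimes>\<^bsub>maps\<^esub> translate s f)"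
      using d[OF s] maps.right_difference_in_filtration[OF P f s d[OF s]]
      by (blast intro: Suc.IH)+
  qed
  then show ?case by simp
qed

text \<open>
  For a map of degree at most \<open>e\<close> the hypothesis on \<open>F\<close> makes the condition on the first \<open>e\<close>
  differences void. The \<open>e\<close>-th difference is constant, so all further ones are trivial and satisfy
  any condition.
\<close>

lemma refined_if_poly_degree_le:
  assumes F: "filtration F" and full: "\<And>k. k \<le> d \<Longrightarrow> F k = carrier G"
  shows "\<lbrakk>f \<in> carrier maps; poly_degree_le sadd S G e f; k + e \<le> d\<rbrakk>
    \<Longrightarrow> f \<in> (maps.refine ^^ m) (pointwise F) k"
proof (induction m arbitrary: k e f)
  case 0
  then show ?case using full[of k] by (auto simp: pointwise_def)
next
  case (Suc m)
  let ?P = "(maps.refine ^^ m) (pointwise F)"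
  have "subgroup (?P (Suc k)) maps"
    using maps.refine_funpow(1)[OF filtration_pointwise[OF F] stable_pointwise, of m]
    by (simp only: maps.filtration_def)
  then have one: "\<one>\<^bsub>maps\<^esub> \<in> ?P (Suc k)" by (rule subgroup.one_closed)
  have "maps.difference s f \<in> ?P (Suc k)" if s: "s \<in> S" for s
  proof (cases e)
    case 0
    then obtain c where c: "c \<in> carrier G" "\<And>t. t \<in> S \<Longrightarrow> f t = c"
      using Suc.prems by auto
    have "left_difference sadd S G s f = \<one>\<^bsub>maps\<^esub>"
      using c s by (auto simp: left_difference_def sadd_closed intro!: restrict_ext)
    then show ?thesis using one Suc.prems(1) by (simp only: left_difference_eq)
  next
    case e: (Suc e')
    show ?thesis
    proof (rule Suc.IH)
      show "maps.difference s f \<in> carrier maps"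
        using s Suc.prems(1) by (rule maps.difference_closed)
      show "poly_degree_le sadd S G e' (maps.difference s f)"
        using Suc.prems(1,2) s e by (simp only: poly_degree_le.simps left_difference_eq[symmetric])
      show "Suc k + e' \<le> d" using Suc.prems(3) e by simp
    qed
  qed
  then show ?case using Suc.IH[OF Suc.prems] by (simp add: maps.mem_refine_iff)
qed

section \<open>The group of polynomial maps\<close>

text \<open>
  A bound for the degrees fixes the speed of the filtration, so that one subgroup of polynomial maps
  serves for all maps below the bound. Two polynomial maps can then be multiplied inside it.
\<close>

lemma poly_degree_le_subset_subgroup:
  assumes "lower_central_series G n = {\<one>}"
  obtains K where "subgroup K maps" "K \<subseteq> polynomial_maps sadd S G"
    "\<And>f e. \<lbrakk>f \<in> carrier maps; poly_degree_le sadd S G e f; e \<le> d\<rbrakk> \<Longrightarrow> f \<in> K"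
proof -
  \<comment> \<open>The factor of the slowed down series must be positive even if all maps are constant. Its term
    \<open>Suc (n * Suc d)\<close> is the \<open>n\<close>-th term of the lower central series.\<close>
  define F where "F k = lower_central_series G ((k - 1) div Suc d)" for k
  let ?N = "Suc (n * Suc d)"
  let ?K = "(maps.refine ^^ ?N) (pointwise F) 0"
  have F: "filtration F"
    unfolding F_def by (rule filtration_slow_lower_central_series) simp
  have triv: "F ?N = {\<one>}"
    unfolding F_def using assms by (simp del: mult_Suc_right)
  have full: "F k = carrier G" if "k \<le> d" for k
    using that by (simp add: F_def)
  have sg: "subgroup ?K maps"
    using maps.refine_funpow(1)[OF filtration_pointwise[OF F] stable_pointwise, of ?N]
    by (simp only: maps.filtration_def)
  have "?K \<subseteq> polynomial_maps sadd S G"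
  proof
    fix f assume f: "f \<in> ?K"
    have "poly_degree_le sadd S G ?N f"
      by (rule poly_degree_le_if_refined[OF F triv f]) simp
    then show "f \<in> polynomial_maps sadd S G"
      using subgroup.mem_carrier[OF sg f]
      by (auto simp: polynomial_maps_def simp del: poly_degree_le.simps)
  qed
  moreover have "f \<in> ?K"
    if "f \<in> carrier maps" "poly_degree_le sadd S G e f" "e \<le> d" for f e
    by (rule refined_if_poly_degree_le[OF F full that(1,2)]) (use that(3) in auto)
  ultimately show ?thesis using sg that by blast
qed

lemma subgroup_polynomial_maps:
  assumes "lower_central_series G n = {\<one>}"
  shows "subgroup (polynomial_maps sadd S G) maps"
proof (rule maps.subgroupI)
  show "polynomial_maps sadd S G \<subseteq> carrier maps"
    by (auto simp: polynomial_maps_def)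
  show "polynomial_maps sadd S G \<noteq> {}"
  proof -
    have "\<one>\<^bsub>maps\<^esub> \<in> polynomial_maps sadd S G"
      using maps.one_closed by (auto simp: polynomial_maps_def intro!: exI[of _ 0] bexI[of _ \<one>])
    then show ?thesis by blast
  qed
next
  fix f assume "f \<in> polynomial_maps sadd S G"
  then obtain d where f: "f \<in> carrier maps" "poly_degree_le sadd S G d f"
    by (auto simp: polynomial_maps_def)
  obtain K where K: "subgroup K maps" "K \<subseteq> polynomial_maps sadd S G" "f \<in> K"
    using poly_degree_le_subset_subgroup[OF assms, of d] f by (metis order_refl)
  then show "inv\<^bsub>maps\<^esub> f \<in> polynomial_maps sadd S G"
    using subgroup.m_inv_closed[OF K(1) K(3)] by blast
next
  fix f g assume "f \<in> polynomial_maps sadd S G" "g \<in> polynomial_maps sadd S G"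
  then obtain d e where f: "f \<in> carrier maps" "poly_degree_le sadd S G d f"
    and g: "g \<in> carrier maps" "poly_degree_le sadd S G e g"
    by (auto simp: polynomial_maps_def)
  obtain K where K: "subgroup K maps" "K \<subseteq> polynomial_maps sadd S G" "f \<in> K" "g \<in> K"
    using poly_degree_le_subset_subgroup[OF assms, of "max d e"] f g
    by (metis max.cobounded1 max.cobounded2)
  then show "f \<otimes>\<^bsub>maps\<^esub> g \<in> polynomial_maps sadd S G"
    using subgroup.m_closed[OF K(1) K(3) K(4)] by blast
qed

lemma group_polynomial_map_group:
  "lower_central_series G n = {\<one>} \<Longrightarrow> group (polynomial_map_group sadd S G)"
  unfolding polynomial_map_group_def
  by (rule maps.subgroup_imp_group) (rule subgroup_polynomial_maps)

lemma constant_map_hom: "constant_map S \<in> hom G (polynomial_map_group sadd S G)"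
proof (rule homI)
  show "constant_map S c \<in> carrier (polynomial_map_group sadd S G)" if "c \<in> carrier G" for c
    using that by (auto simp: constant_map_def polynomial_map_group_def polynomial_maps_def
        intro!: exI[of _ 0] bexI[of _ c])
qed (auto simp: constant_map_def polynomial_map_group_def intro!: restrict_ext)

lemma evaluation_hom:
  "s \<in> S \<Longrightarrow> (\<lambda>f. f s) \<in> hom (polynomial_map_group sadd S G) G"
  by (rule homI) (auto simp: polynomial_map_group_def polynomial_maps_def)

text \<open>
  One direction restricts to constant maps, the other one evaluates at all points of \<open>S\<close>.
\<close>

lemma lower_central_series_polynomial_map_group_trivial_iff:
  assumes "S \<noteq> {}" and "group (polynomial_map_group sadd S G)"
  shows "lower_central_series (polynomial_map_group sadd S G) k
      = {\<one>\<^bsub>polynomial_map_group sadd S G\<^esub>} \<longleftrightarrow> lower_central_series G k = {\<one>}"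
    (is "lower_central_series ?P k = _ \<longleftrightarrow> _")
proof
  interpret P: group ?P by fact
  have one: "\<one>\<^bsub>?P\<^esub> = constant_map S \<one>"
    by (simp add: polynomial_map_group_def constant_map_def)
  {
    interpret c: group_hom G ?P "constant_map S"
      by unfold_locales (rule constant_map_hom)
    assume "lower_central_series ?P k = {\<one>\<^bsub>?P\<^esub>}"
    then have "constant_map S x = constant_map S \<one>" if "x \<in> lower_central_series G k" for x
      using c.image_lower_central_series[of k] that by auto
    moreover obtain s where "s \<in> S" using assms(1) by blast
    then have "constant_map S x s = x" for x by (simp add: constant_map_def)
    ultimately have "lower_central_series G k \<subseteq> {\<one>}"
      by (metis singletonI subsetI)
    then show "lower_central_series G k = {\<one>}"
      using subgroup.one_closed[OF subgroup_lower_central_series] by blast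
  }
  assume triv: "lower_central_series G k = {\<one>}"
  have "f = \<one>\<^bsub>?P\<^esub>" if f: "f \<in> lower_central_series ?P k" for f
  proof -
    have "f s = \<one>" if "s \<in> S" for s
    proof -
      interpret e: group_hom ?P G "\<lambda>f. f s"
        by unfold_locales (rule evaluation_hom[OF that])
      show ?thesis using e.image_lower_central_series[of k] f triv by auto
    qed
    moreover have "f \<in> extensional S"
      using subgroup.mem_carrier[OF P.subgroup_lower_central_series f]
      by (simp add: polynomial_map_group_def polynomial_maps_def PiE_iff)
    ultimately show ?thesis
      unfolding one constant_map_def by (intro extensionalityI[of f S]) simp_all
  qed
  then show "lower_central_series ?P k = {\<one>\<^bsub>?P\<^esub>}"
    using subgroup.one_closed[OF P.subgroup_lower_central_series] by blast
qed

end

theorem corollary6: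
  fixes S :: "'s set" and sadd :: "'s \<Rightarrow> 's \<Rightarrow> 's"
    and G :: "('g, 'b) monoid_scheme" and n :: nat
  assumes "commutative_semigroup S sadd" and "S \<noteq> {}"
    and "nilpotent_group G" and "nilpotency_class G = n"
  shows "nilpotent_group (polynomial_map_group sadd S G)
    \<and> nilpotency_class (polynomial_map_group sadd S G) = n
    \<and> subgroup (constant_map S ` carrier G) (polynomial_map_group sadd S G)
    \<and> constant_map S \<in> iso G ((polynomial_map_group sadd S G)
        \<lparr>carrier := constant_map S ` carrier G\<rparr>)"
proof -
  interpret nilpotent_group G by fact
  interpret commutative_semigroup S sadd by fact
  interpret semigroup_group_maps S sadd G ..
  let ?P = "polynomial_map_group sadd S G"
  obtain k where k: "lower_central_series G k = {\<one>\<^bsub>G\<^esub>}"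
    using nilpotent by blast
  interpret P: group ?P by (rule group_polynomial_map_group[OF k])
  interpret c: group_hom G ?P "constant_map S"
    by unfold_locales (rule constant_map_hom)
  note triv_iff = lower_central_series_polynomial_map_group_trivial_iff[OF assms(2) P.is_group]
  have "nilpotent_group ?P"
    by unfold_locales (use k triv_iff in blast)
  moreover have "nilpotency_class ?P = n"
    using assms(4) by (simp add: nilpotency_class_def triv_iff)
  moreover have "inj_on (constant_map S) (carrier G)"
    using assms(2) by (auto simp: inj_on_def constant_map_def restrict_def fun_eq_iff)
  then have "constant_map S \<in> iso G (?P\<lparr>carrier := constant_map S ` carrier G\<rparr>)"
    using constant_map_hom by (auto simp: iso_def hom_def bij_betw_def)
  ultimately show ?thesis using c.img_is_subgroup by blast
qed

end
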